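(* Let $G$ be a finite group of order $q$, let $(g_1,\ldots,g_q)$ be an ordering of the elements of $G$, and let $C(G)=\{(g_1g,\ldots,g_qg): g\in G\}$, a code in the Hamming graph $H(q,q)$ over the alphabet $G$. Then $C(G)$ is $(S_G\times S_G)$-neighbour transitive, i.e. there is a subgroup $X\leq\mathrm{Aut}(H(q,q))$ with $X\cong S_G\times S_G$ such that $C(G)$ is $X$-neighbour transitive.
   Context: $S_G$ is the symmetric group on the set $G$. The Hamming graph $H(q,q)$ over alphabet $G$ has vertex set $G^q$, vertices adjacent iff they differ in exactly one entry. Its automorphism group is $S_G^q\rtimes S_q$ (permuting symbols in each coordinate and permuting coordinates). For a code $C$, its set of neighbours $C_1$ is the set of vertices at Hamming distance exactly $1$ from $C$; $C$ is $X$-neighbour transitive if $C$ and $C_1$ are both $X$-orbits. (Different orderings of $G$ give equivalent codes, so $C(G)$ is considered up to equivalence.)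
   Formalization: For the trivial group (q = 1) the set of neighbours C_1 is empty and so is not an orbit; in that case the formal theorem states instead that C(G) is an X-orbit and C_1 is empty, while the full claim is proved for all q ≥ 2. *)

theory Defs
  imports "HOL-Algebra.Bij" "HOL-Algebra.Group_Action"
begin

text \<open>Vertices of the Hamming graph of length \<open>n\<close> over the alphabet \<open>Q\<close> are \<open>n\<close>-tuples, encoded
  as functions on \<open>{..<n}\<close> that are \<open>undefined\<close> elsewhere, so that equal tuples are equal functions.\<close>

definition hamming_verts :: "nat \<Rightarrow> 'a set \<Rightarrow> (nat \<Rightarrow> 'a) set" where
  "hamming_verts n Q = {..<n} \<rightarrow>\<^sub>E Q"

definition hamming_dist :: "nat \<Rightarrow> (nat \<Rightarrow> 'a) \<Rightarrow> (nat \<Rightarrow> 'a) \<Rightarrow> nat" where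
  "hamming_dist n x y = card {i. i < n \<and> x i \<noteq> y i}"

definition hamming_adj :: "nat \<Rightarrow> (nat \<Rightarrow> 'a) \<Rightarrow> (nat \<Rightarrow> 'a) \<Rightarrow> bool" where
  "hamming_adj n x y \<longleftrightarrow> (\<exists>!i. i < n \<and> x i \<noteq> y i)"

definition hamming_aut :: "nat \<Rightarrow> 'a set \<Rightarrow> ((nat \<Rightarrow> 'a) \<Rightarrow> (nat \<Rightarrow> 'a)) monoid" where
  "hamming_aut n Q = (BijGroup (hamming_verts n Q))
     \<lparr>carrier := {f \<in> Bij (hamming_verts n Q).
        \<forall>x\<in>hamming_verts n Q. \<forall>y\<in>hamming_verts n Q.
          hamming_adj n (f x) (f y) \<longleftrightarrow> hamming_adj n x y}\<rparr>"

definition code_neighbours :: "nat \<Rightarrow> 'a set \<Rightarrow> (nat \<Rightarrow> 'a) set \<Rightarrow> (nat \<Rightarrow> 'a) set" where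
  "code_neighbours n Q C =
     {v \<in> hamming_verts n Q. C \<noteq> {} \<and> (INF c\<in>C. hamming_dist n v c) = 1}"

text \<open>\<open>X\<close> is meant to be a subgroup of \<open>hamming_aut n Q\<close>; it acts on vertices by evaluation.\<close>

definition is_orbit :: "nat \<Rightarrow> 'a set \<Rightarrow> ((nat \<Rightarrow> 'a) \<Rightarrow> (nat \<Rightarrow> 'a)) set \<Rightarrow> (nat \<Rightarrow> 'a) set \<Rightarrow> bool" where
  "is_orbit n Q X A \<longleftrightarrow>
     A \<in> orbits ((hamming_aut n Q)\<lparr>carrier := X\<rparr>) (hamming_verts n Q) (\<lambda>f v. f v)"

text \<open>Orbits are nonempty, so a code without neighbours is never neighbour transitive. For the code
  of a group this happens exactly for the trivial group, whose Hamming graph is a single vertex.\<close>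

definition neighbour_transitive ::
    "nat \<Rightarrow> 'a set \<Rightarrow> ((nat \<Rightarrow> 'a) \<Rightarrow> (nat \<Rightarrow> 'a)) set \<Rightarrow> (nat \<Rightarrow> 'a) set \<Rightarrow> bool" where
  "neighbour_transitive n Q X C \<longleftrightarrow>
     is_orbit n Q X C \<and> is_orbit n Q X (code_neighbours n Q C)"

text \<open>The codewords \<open>(g\<^sub>1h, \<dots>, g\<^sub>qh)\<close> for \<open>h\<close> in the group, with positions numbered from \<open>0\<close>.\<close>

definition group_code :: "('a, 'b) monoid_scheme \<Rightarrow> (nat \<Rightarrow> 'a) \<Rightarrow> (nat \<Rightarrow> 'a) set" where
  "group_code G g = (\<lambda>h. \<lambda>i\<in>{..<order G}. g i \<otimes>\<^bsub>G\<^esub> h) ` carrier G"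

end

theory Submission
  imports Defs "HOL-Combinatorics.Transposition"
begin

text \<open>Untwisting the \<open>i\<close>-th coordinate by \<open>x \<mapsto> g\<^sub>i x\<close> turns \<open>C(G)\<close> into the repetition code, on which
  one copy of \<open>S\<^sub>G\<close> acts by relabelling all coordinates simultaneously and the other by permuting the
  coordinates. The neighbours are the words obtained from a constant word \<open>h\<close> by changing one
  entry to some \<open>b \<noteq> h\<close>, and they form one orbit because \<open>S\<^sub>G\<close> is \<open>2\<close>-transitive on symbols and
  transitive on positions.\<close>

section \<open>The automorphism group of the Hamming graph and subgroups as images\<close>

lemma group_hamming_aut: "group (hamming_aut n Q)"
proof -
  let ?V = "hamming_verts n Q"
  let ?A = "{f \<in> Bij ?V. \<forall>x\<in>?V. \<forall>y\<in>?V. hamming_adj n (f x) (f y) \<longleftrightarrow> hamming_adj n x y}"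
  interpret B: group "BijGroup ?V" by (rule group_BijGroup)
  have "subgroup ?A (BijGroup ?V)"
  proof (rule B.subgroupI)
    show "?A \<subseteq> carrier (BijGroup ?V)" by (auto simp: BijGroup_def)
    have "(\<lambda>x\<in>?V. x) \<in> ?A" by (simp add: id_Bij)
    then show "?A \<noteq> {}" by blast
  next
    fix f assume f: "f \<in> ?A"
    then have fB: "f \<in> Bij ?V" and inj: "f ` ?V = ?V"
      by (auto simp: Bij_def bij_betw_def)
    have "hamming_adj n (inv_into ?V f x) (inv_into ?V f y) \<longleftrightarrow> hamming_adj n x y"
      if "x \<in> ?V" "y \<in> ?V" for x y
    proof -
      have "inv_into ?V f x \<in> ?V" "inv_into ?V f y \<in> ?V"
        using fB that by (auto intro: Bij_inv_into_mem)
      moreover have "f (inv_into ?V f x) = x" "f (inv_into ?V f y) = y"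
        using that inj f_inv_into_f[of _ f ?V] by simp_all
      \<comment> \<open>Adjacency is preserved in both directions, so the condition on
        \<open>f\<close> at the two preimages is the condition on the inverse.\<close>
      ultimately show ?thesis using f by force
    qed
    then show "inv\<^bsub>BijGroup ?V\<^esub> f \<in> ?A"
      using fB by (simp add: inv_BijGroup restrict_inv_into_Bij)
  next
    fix f h assume "f \<in> ?A" "h \<in> ?A"
    then show "f \<otimes>\<^bsub>BijGroup ?V\<^esub> h \<in> ?A"
      using Bij_imp_funcset[of h ?V]
      by (auto simp: BijGroup_def compose_Bij compose_eq Pi_iff)
  qed
  then show ?thesis
    unfolding hamming_aut_def by (rule subgroup.subgroup_is_group) (rule group_BijGroup)
qed

text \<open>Reduces preservation of adjacency to counting positions of disagreement, a number that
  permuting positions does not change.\<close>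

lemma hamming_adj_iff_card:
  "hamming_adj n x y \<longleftrightarrow> card {i. i < n \<and> x i \<noteq> y i} = 1"
proof -
  have "(\<exists>!i. P i) \<longleftrightarrow> (\<exists>j. \<forall>i. P i \<longleftrightarrow> i = j)" for P :: "nat \<Rightarrow> bool"
    by (auto simp: Ex1_def)
  then show ?thesis by (simp add: hamming_adj_def card_1_singleton_iff set_eq_iff)
qed

text \<open>An injective homomorphism is an isomorphism onto its image; the required subgroup arises
  as such an image of the product of two symmetric groups.\<close>

lemma group_iso_image:
  assumes "group G" "group H" "f \<in> hom G H" "inj_on f (carrier G)"
  shows "subgroup (f ` carrier G) H" "H\<lparr>carrier := f ` carrier G\<rparr> \<cong> G"
proof -
  interpret group_hom G H f
    using assms by (simp add: group_hom_def group_hom_axioms_def)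
  show "subgroup (f ` carrier G) H" by (rule img_is_subgroup)
  have "f \<in> iso G (H\<lparr>carrier := f ` carrier G\<rparr>)"
    using assms(4) by (auto simp: iso_def hom_def bij_betw_def)
  then show "H\<lparr>carrier := f ` carrier G\<rparr> \<cong> G"
    using G.iso_sym is_isoI by blast
qed

section \<open>Transitivity of the symmetric group on points and on ordered pairs\<close>

lemma restrict_transpose_Bij:
  assumes "a \<in> S" "b \<in> S"
  shows "restrict (transpose a b) S \<in> Bij S"
proof -
  have "bij_betw (transpose a b) S S" using assms by simp
  then have "bij_betw (restrict (transpose a b) S) S S"
    by (subst bij_betw_restrict_eq)
  then show ?thesis by (simp add: Bij_def)
qed

lemma Bij_transitive:
  assumes "a \<in> S" "b \<in> S"
  obtains f where "f \<in> Bij S" "f a = b"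
  using restrict_transpose_Bij[OF assms] assms by (metis restrict_apply' transpose_apply_first)

text \<open>A first permutation takes \<open>a\<close> to \<open>c\<close>. A transposition then
  takes the image of \<open>b\<close> to \<open>d\<close> and fixes \<open>c\<close>, because both
  points it swaps differ from \<open>c\<close>.\<close>

lemma Bij_two_transitive:
  assumes "a \<in> S" "b \<in> S" "a \<noteq> b" "c \<in> S" "d \<in> S" "c \<noteq> d"
  obtains f where "f \<in> Bij S" "f a = c" "f b = d"
proof -
  obtain f1 where f1: "f1 \<in> Bij S" "f1 a = c" using Bij_transitive assms by metis
  have f1b: "f1 b \<in> S" "f1 b \<noteq> c"
    using f1 assms by (auto simp: Bij_def bij_betw_def inj_on_def)
  define f where "f = compose S (restrict (transpose (f1 b) d) S) f1"
  show ?thesis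
  proof
    show "f \<in> Bij S" unfolding f_def
      by (intro compose_Bij restrict_transpose_Bij f1 f1b assms)
    show "f a = c" "f b = d"
      using f1 f1b assms by (auto simp: f_def compose_eq)
  qed
qed

section \<open>Repetition codes twisted in each coordinate\<close>

text \<open>\<open>t i\<close> stands for left multiplication by the \<open>i\<close>-th group
  element; the group law enters only through the bijectivity of these maps. \<open>g\<close> labels
  positions by symbols, so that \<open>Bij Q\<close> can permute positions as well as relabel
  symbols.\<close>

locale latin_code =
  fixes n :: nat and Q :: "'a set" and g :: "nat \<Rightarrow> 'a" and t :: "nat \<Rightarrow> 'a \<Rightarrow> 'a"
  assumes bij_g: "bij_betw g {..<n} Q"
    and bij_t: "i < n \<Longrightarrow> bij_betw (t i) Q Q"
begin

abbreviation u :: "nat \<Rightarrow> 'a \<Rightarrow> 'a" where "u i \<equiv> inv_into Q (t i)"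

lemma g_in: "i < n \<Longrightarrow> g i \<in> Q"
  using bij_g by (auto simp: bij_betw_def)

lemma t_in: "i < n \<Longrightarrow> a \<in> Q \<Longrightarrow> t i a \<in> Q"
  using bij_t by (auto simp: bij_betw_def)

lemma t_eq_iff: "i < n \<Longrightarrow> a \<in> Q \<Longrightarrow> b \<in> Q \<Longrightarrow> t i a = t i b \<longleftrightarrow> a = b"
  using bij_t by (auto simp: bij_betw_def inj_on_def)

lemma u_in: "i < n \<Longrightarrow> a \<in> Q \<Longrightarrow> u i a \<in> Q"
  using bij_t by (metis bij_betw_def inv_into_into)

lemma t_u: "i < n \<Longrightarrow> a \<in> Q \<Longrightarrow> t i (u i a) = a"
  using bij_t by (metis bij_betw_inv_into_right)

lemma u_t: "i < n \<Longrightarrow> a \<in> Q \<Longrightarrow> u i (t i a) = a"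
  using bij_t by (metis bij_betw_inv_into_left)

section \<open>Permutations of the positions induced by permutations of the alphabet\<close>

lemma Bij_in: "\<sigma> \<in> Bij Q \<Longrightarrow> a \<in> Q \<Longrightarrow> \<sigma> a \<in> Q"
  using Bij_imp_funcset by blast

lemma Bij_eq_iff: "\<sigma> \<in> Bij Q \<Longrightarrow> a \<in> Q \<Longrightarrow> b \<in> Q \<Longrightarrow> \<sigma> a = \<sigma> b \<longleftrightarrow> a = b"
  by (auto simp: Bij_def bij_betw_def inj_on_def)

text \<open>\<open>pos \<pi> i\<close> is the position whose entry \<open>\<pi>\<close> moves to position \<open>i\<close>, hence the inverse of \<open>\<pi>\<close>.\<close>

definition pos :: "('a \<Rightarrow> 'a) \<Rightarrow> nat \<Rightarrow> nat" where
  "pos \<pi> i = inv_into {..<n} g (inv_into Q \<pi> (g i))"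

lemma pos_less:
  assumes "\<pi> \<in> Bij Q" "i < n"
  shows "pos \<pi> i < n"
proof -
  have "inv_into Q \<pi> (g i) \<in> g ` {..<n}"
    using assms Bij_inv_into_mem g_in bij_g by (metis bij_betw_def)
  then have "pos \<pi> i \<in> {..<n}" unfolding pos_def by (rule inv_into_into)
  then show ?thesis by simp
qed

lemma Bij_g_pos:
  assumes "\<pi> \<in> Bij Q" "i < n"
  shows "\<pi> (g (pos \<pi> i)) = g i"
proof -
  have "g (pos \<pi> i) = inv_into Q \<pi> (g i)"
    unfolding pos_def using assms Bij_inv_into_mem g_in bij_g
    by (metis bij_betw_inv_into_right)
  moreover have "\<pi> ` Q = Q" using assms by (auto simp: Bij_def bij_betw_def)
  ultimately show ?thesis using assms g_in by (simp add: f_inv_into_f)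
qed

lemma pos_eqI:
  assumes "\<pi> \<in> Bij Q" "i < n" "j < n" "\<pi> (g j) = g i"
  shows "pos \<pi> i = j"
proof -
  have "g (pos \<pi> i) = g j"
    using assms Bij_g_pos Bij_eq_iff g_in pos_less by metis
  then show ?thesis
    using bij_g assms pos_less by (auto simp: bij_betw_def inj_on_def)
qed

text \<open>The order is reversed because \<open>pos\<close> inverts. As \<open>act\<close> reads
  its entry at \<open>pos \<pi> i\<close>, a second reversal follows, which makes \<open>act\<close>
  a homomorphism and not an antihomomorphism.\<close>

lemma pos_compose:
  assumes "\<pi> \<in> Bij Q" "\<rho> \<in> Bij Q" "i < n"
  shows "pos (compose Q \<pi> \<rho>) i = pos \<rho> (pos \<pi> i)"
  using assms by (intro pos_eqI) (auto simp: compose_Bij pos_less Bij_g_pos compose_eq g_in)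

lemma pos_surj:
  assumes "\<pi> \<in> Bij Q" "j < n"
  obtains i where "i < n" "pos \<pi> i = j"
proof -
  have "\<pi> (g j) \<in> g ` {..<n}" using assms Bij_in g_in bij_g by (metis bij_betw_def)
  then obtain i where "i < n" "\<pi> (g j) = g i" by auto
  then show ?thesis using assms pos_eqI that by metis
qed

lemma pos_eq_iff:
  assumes "\<pi> \<in> Bij Q" "i < n" "j < n"
  shows "pos \<pi> i = pos \<pi> j \<longleftrightarrow> i = j"
  using assms Bij_g_pos bij_g by (metis bij_betw_def inj_on_def lessThan_iff)

section \<open>The action on vertices by graph automorphisms\<close>

text \<open>An entry is untwisted at its old position, relabelled by the first component, and
  twisted again at its new position, which the second component determines. Restriction to the
  vertices gives the extensionality that \<open>Bij\<close> demands.\<close>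

definition act :: "('a \<Rightarrow> 'a) \<times> ('a \<Rightarrow> 'a) \<Rightarrow> (nat \<Rightarrow> 'a) \<Rightarrow> nat \<Rightarrow> 'a" where
  "act s = (\<lambda>v\<in>hamming_verts n Q. \<lambda>i\<in>{..<n}.
     t i (fst s (u (pos (snd s) i) (v (pos (snd s) i)))))"

lemma act_apply:
  "v \<in> hamming_verts n Q \<Longrightarrow> i < n \<Longrightarrow> act (\<sigma>, \<pi>) v i = t i (\<sigma> (u (pos \<pi> i) (v (pos \<pi> i))))"
  by (simp add: act_def)

lemma vert_in: "v \<in> hamming_verts n Q \<Longrightarrow> i < n \<Longrightarrow> v i \<in> Q"
  by (auto simp: hamming_verts_def)

lemma vert_eqI:
  "v \<in> hamming_verts n Q \<Longrightarrow> w \<in> hamming_verts n Q \<Longrightarrow> (\<And>i. i < n \<Longrightarrow> v i = w i) \<Longrightarrow> v = w"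
  unfolding hamming_verts_def by (rule PiE_ext) auto

lemma act_in:
  assumes "\<sigma> \<in> Bij Q" "\<pi> \<in> Bij Q" "v \<in> hamming_verts n Q"
  shows "act (\<sigma>, \<pi>) v \<in> hamming_verts n Q"
  using assms vert_in by (auto simp: act_def t_in u_in Bij_in pos_less hamming_verts_def)

lemma act_compose:
  assumes "\<sigma> \<in> Bij Q" "\<pi> \<in> Bij Q" "\<sigma>' \<in> Bij Q" "\<pi>' \<in> Bij Q"
  shows "act (compose Q \<sigma> \<sigma>', compose Q \<pi> \<pi>') =
    compose (hamming_verts n Q) (act (\<sigma>, \<pi>)) (act (\<sigma>', \<pi>'))"
    (is "?l = ?r")
proof (rule extensionalityI)
  show "?l \<in> extensional (hamming_verts n Q)" by (simp add: act_def)
  show "?r \<in> extensional (hamming_verts n Q)" by simp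
  fix v assume v: "v \<in> hamming_verts n Q"
  show "?l v = ?r v"
  proof (rule vert_eqI)
    show "?l v \<in> hamming_verts n Q" using assms v by (simp add: act_in compose_Bij)
    show "?r v \<in> hamming_verts n Q" using assms v by (simp add: act_in compose_eq)
    \<comment> \<open>The twist put on by the inner map at position \<open>pos \<pi> i\<close> is
      cancelled by the untwisting in the outer map.\<close>
    show "?l v i = ?r v i" if "i < n" for i
      using that assms v
      by (simp add: compose_eq act_apply act_in u_t u_in Bij_in pos_less pos_compose vert_in)
  qed
qed

lemma act_id: "act (\<lambda>a\<in>Q. a, \<lambda>a\<in>Q. a) = (\<lambda>v\<in>hamming_verts n Q. v)"
proof (rule extensionalityI)
  show "act (\<lambda>a\<in>Q. a, \<lambda>a\<in>Q. a) \<in> extensional (hamming_verts n Q)" by (simp add: act_def)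
  fix v assume v: "v \<in> hamming_verts n Q"
  have "pos (\<lambda>a\<in>Q. a) i = i" if "i < n" for i
    using that by (intro pos_eqI) (auto simp: id_Bij g_in)
  then show "act (\<lambda>a\<in>Q. a, \<lambda>a\<in>Q. a) v = (\<lambda>v\<in>hamming_verts n Q. v) v"
    using v by (intro vert_eqI) (auto simp: act_in id_Bij act_apply u_in t_u vert_in)
qed simp

text \<open>Inverting both permutations gives a two-sided inverse, by \<open>act_compose\<close> and
  \<open>act_id\<close>.\<close>

lemma act_Bij:
  assumes "\<sigma> \<in> Bij Q" "\<pi> \<in> Bij Q"
  shows "act (\<sigma>, \<pi>) \<in> Bij (hamming_verts n Q)"
proof -
  let ?V = "hamming_verts n Q"
  have inv: "\<exists>\<tau>\<in>Bij Q. compose Q \<tau> \<sigma> = (\<lambda>a\<in>Q. a) \<and> compose Q \<sigma> \<tau> = (\<lambda>a\<in>Q. a)"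
    if "\<sigma> \<in> Bij Q" for \<sigma>
  proof (intro bexI conjI)
    show "restrict (inv_into Q \<sigma>) Q \<in> Bij Q" using that by (rule restrict_inv_into_Bij)
    show "compose Q (restrict (inv_into Q \<sigma>) Q) \<sigma> = (\<lambda>a\<in>Q. a)"
      using that by (rule Bij_compose_restrict_eq)
    have "\<sigma> ` Q = Q" using that by (simp add: Bij_def bij_betw_def)
    then show "compose Q \<sigma> (restrict (inv_into Q \<sigma>) Q) = (\<lambda>a\<in>Q. a)"
      using f_inv_into_f[of _ \<sigma> Q] by (auto simp: compose_def)
  qed
  obtain \<sigma>' \<pi>' where i: "\<sigma>' \<in> Bij Q" "\<pi>' \<in> Bij Q"
    "compose Q \<sigma>' \<sigma> = (\<lambda>a\<in>Q. a)" "compose Q \<pi>' \<pi> = (\<lambda>a\<in>Q. a)"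
    "compose Q \<sigma> \<sigma>' = (\<lambda>a\<in>Q. a)" "compose Q \<pi> \<pi>' = (\<lambda>a\<in>Q. a)"
    using inv assms by meson
  have "compose ?V (act (\<sigma>', \<pi>')) (act (\<sigma>, \<pi>)) = (\<lambda>v\<in>?V. v)"
    "compose ?V (act (\<sigma>, \<pi>)) (act (\<sigma>', \<pi>')) = (\<lambda>v\<in>?V. v)"
    using act_compose[of \<sigma>' \<pi>' \<sigma> \<pi>] act_compose[of \<sigma> \<pi> \<sigma>' \<pi>'] i assms by (simp_all add: act_id)
  then have "\<forall>v\<in>?V. act (\<sigma>', \<pi>') (act (\<sigma>, \<pi>) v) = v \<and> act (\<sigma>, \<pi>) (act (\<sigma>', \<pi>') v) = v"
    by (auto simp: compose_def fun_eq_iff split: if_splits)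
  then have "bij_betw (act (\<sigma>, \<pi>)) ?V ?V"
    using assms i by (intro bij_betw_byWitness[of _ "act (\<sigma>', \<pi>')"]) (auto simp: act_in)
  then show ?thesis by (simp add: Bij_def act_def)
qed

text \<open>Relabelling and twisting are injective, so \<open>pos \<pi>\<close> carries the
  positions where the images differ bijectively to those where \<open>v\<close> and \<open>w\<close>
  differ.\<close>

lemma act_adj:
  assumes "\<sigma> \<in> Bij Q" "\<pi> \<in> Bij Q" "v \<in> hamming_verts n Q" "w \<in> hamming_verts n Q"
  shows "hamming_adj n (act (\<sigma>, \<pi>) v) (act (\<sigma>, \<pi>) w) \<longleftrightarrow> hamming_adj n v w"
proof -
  have *: "act (\<sigma>, \<pi>) v i \<noteq> act (\<sigma>, \<pi>) w i \<longleftrightarrow> v (pos \<pi> i) \<noteq> w (pos \<pi> i)" if "i < n" for i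
  proof -
    have "u j a = u j b \<longleftrightarrow> a = b" if "j < n" "a \<in> Q" "b \<in> Q" for j a b
      using that t_u by metis
    then show ?thesis
      using assms that by (simp add: act_apply t_eq_iff Bij_eq_iff Bij_in u_in pos_less vert_in)
  qed
  have "{i. i < n \<and> v i \<noteq> w i} = pos \<pi> ` {i. i < n \<and> act (\<sigma>, \<pi>) v i \<noteq> act (\<sigma>, \<pi>) w i}"
  proof (intro equalityI subsetI)
    fix j assume j: "j \<in> {i. i < n \<and> v i \<noteq> w i}"
    then obtain i where "i < n" "pos \<pi> i = j" using pos_surj[OF assms(2)] by blast
    then show "j \<in> pos \<pi> ` {i. i < n \<and> act (\<sigma>, \<pi>) v i \<noteq> act (\<sigma>, \<pi>) w i}"
      using j * by blast
  qed (use assms(2) pos_less * in auto)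
  moreover have "inj_on (pos \<pi>) {i. i < n \<and> act (\<sigma>, \<pi>) v i \<noteq> act (\<sigma>, \<pi>) w i}"
    using pos_eq_iff[OF assms(2)] by (simp add: inj_on_def)
  ultimately have "card {i. i < n \<and> v i \<noteq> w i} = card {i. i < n \<and> act (\<sigma>, \<pi>) v i \<noteq> act (\<sigma>, \<pi>) w i}"
    by (simp add: card_image)
  then show ?thesis by (simp add: hamming_adj_iff_card)
qed

lemma act_hom: "act \<in> hom (BijGroup Q \<times>\<times> BijGroup Q) (hamming_aut n Q)"
proof (rule homI)
  fix s assume "s \<in> carrier (BijGroup Q \<times>\<times> BijGroup Q)"
  then show "act s \<in> carrier (hamming_aut n Q)"
    by (auto simp: hamming_aut_def BijGroup_def DirProd_def act_Bij act_adj)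
next
  fix s s' assume "s \<in> carrier (BijGroup Q \<times>\<times> BijGroup Q)" "s' \<in> carrier (BijGroup Q \<times>\<times> BijGroup Q)"
  then show "act (s \<otimes>\<^bsub>BijGroup Q \<times>\<times> BijGroup Q\<^esub> s') = act s \<otimes>\<^bsub>hamming_aut n Q\<^esub> act s'"
    by (auto simp: hamming_aut_def BijGroup_def DirProd_def act_Bij act_compose)
qed

section \<open>Words with one changed entry, and faithfulness of the action\<close>

text \<open>Untwisted, this is the constant word \<open>h\<close> with entry \<open>i\<close>
  changed to \<open>b\<close>. The case \<open>b = h\<close> gives the codewords, so one formula for
  the action serves both orbits.\<close>

definition word :: "nat \<Rightarrow> 'a \<Rightarrow> 'a \<Rightarrow> nat \<Rightarrow> 'a" where
  "word i h b = (\<lambda>j\<in>{..<n}. t j (if j = i then b else h))"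

lemma word_in: "h \<in> Q \<Longrightarrow> b \<in> Q \<Longrightarrow> word i h b \<in> hamming_verts n Q"
  by (auto simp: word_def hamming_verts_def t_in)

lemma word_apply: "j < n \<Longrightarrow> word i h b j = t j (if j = i then b else h)"
  by (simp add: word_def)

lemma word_same: "word i h h = (\<lambda>j\<in>{..<n}. t j h)"
  by (auto simp: word_def)

lemma act_word:
  assumes "\<sigma> \<in> Bij Q" "\<pi> \<in> Bij Q" "h \<in> Q" "b \<in> Q" "i < n"
  shows "act (\<sigma>, \<pi>) (word (pos \<pi> i) h b) = word i (\<sigma> h) (\<sigma> b)"
proof (rule vert_eqI)
  fix j assume "j < n"
  then show "act (\<sigma>, \<pi>) (word (pos \<pi> i) h b) j = word i (\<sigma> h) (\<sigma> b) j"
    using assms by (simp add: act_apply word_in word_apply pos_less pos_eq_iff u_t)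
qed (use assms in \<open>simp_all add: act_in word_in Bij_in\<close>)

text \<open>Codewords determine \<open>\<sigma>\<close>, since untwisted they are constant and do
  not notice a permutation of positions. Words with one changed entry then reveal where each
  position goes, which determines \<open>\<pi>\<close>.\<close>

lemma act_inj: "inj_on act (Bij Q \<times> Bij Q)"
proof (rule inj_onI, clarify)
  fix \<sigma> \<pi> \<sigma>' \<pi>'
  assume B: "\<sigma> \<in> Bij Q" "\<pi> \<in> Bij Q" "\<sigma>' \<in> Bij Q" "\<pi>' \<in> Bij Q"
    and eq: "act (\<sigma>, \<pi>) = act (\<sigma>', \<pi>')"
  have app: "\<sigma> (if pos \<pi> j = i then b else h) = \<sigma>' (if pos \<pi>' j = i then b else h)"
    if "h \<in> Q" "b \<in> Q" "i < n" "j < n" for h b i j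
  proof -
    let ?x = "if pos \<pi> j = i then b else h" and ?y = "if pos \<pi>' j = i then b else h"
    have "?x \<in> Q" "?y \<in> Q" using that by simp_all
    moreover have "act (\<sigma>, \<pi>) (word i h b) j = t j (\<sigma> ?x)"
      "act (\<sigma>', \<pi>') (word i h b) j = t j (\<sigma>' ?y)"
      using calculation that B by (simp_all only: act_apply word_in word_apply pos_less u_t)
    ultimately show ?thesis using eq that B by (simp only: t_eq_iff Bij_in)
  qed
  \<comment> \<open>If there is a symbol, there is a position, so the comparison can be made at
    position \<open>0\<close>.\<close>
  have n: "0 < n" if "a \<in> Q" for a using that bij_g by (cases n) (auto simp: bij_betw_def)
  have \<sigma>: "\<sigma> a = \<sigma>' a" if "a \<in> Q" for a using app[of a a 0 0] n that by simp
  then have "\<sigma> = \<sigma>'" using B by (intro extensionalityI[of _ Q]) (auto simp: Bij_def)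
  moreover have "\<pi> a = \<pi>' a" if "a \<in> Q" for a
  proof -
    have "a \<in> g ` {..<n}" "\<pi> a \<in> g ` {..<n}"
      using that bij_g Bij_in[OF B(2)] by (simp_all add: bij_betw_def)
    then obtain i j where ij: "i < n" "g i = a" "j < n" "g j = \<pi> a" by force
    then have pj: "pos \<pi> j = i" using B by (intro pos_eqI) auto
    have "pos \<pi>' j = i"
    proof (rule ccontr)
      assume neq: "pos \<pi>' j \<noteq> i"
      \<comment> \<open>The label of the wrong position differs from \<open>a = g i\<close>. At
        position \<open>j\<close>, the first image of \<open>word i ?h a\<close> comes from the
        changed entry \<open>a\<close>, the second from the background symbol
        \<open>?h\<close>.\<close>
      let ?h = "g (pos \<pi>' j)"
      have h: "?h \<in> Q" using B ij g_in pos_less by simp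
      have "\<sigma> a = \<sigma>' ?h" using app[of ?h a i j] ij pj neq h that by simp
      then have "a = ?h" using \<sigma> h that B Bij_eq_iff by metis
      then show False using neq ij B pos_less bij_g by (auto simp: bij_betw_def inj_on_def)
    qed
    then show ?thesis using Bij_g_pos[of \<pi>' j] B ij by simp
  qed
  then have "\<pi> = \<pi>'" using B by (intro extensionalityI[of _ Q]) (auto simp: Bij_def)
  ultimately show "\<sigma> = \<sigma>' \<and> \<pi> = \<pi>'" ..
qed

section \<open>The code, its neighbours and their orbits\<close>

definition code :: "(nat \<Rightarrow> 'a) set" where
  "code = (\<lambda>h. \<lambda>j\<in>{..<n}. t j h) ` Q"

lemma is_orbitI:
  assumes "x \<in> hamming_verts n Q" "A = (\<lambda>s. act s x) ` (Bij Q \<times> Bij Q)"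
  shows "is_orbit n Q (act ` (Bij Q \<times> Bij Q)) A"
  using assms unfolding is_orbit_def orbits_def orbit_def by auto

text \<open>Position permutations fix every codeword, and transitivity of the first factor on
  symbols reaches all of them from one.\<close>

lemma code_orbit:
  assumes "0 < n"
  shows "is_orbit n Q (act ` (Bij Q \<times> Bij Q)) code"
proof (rule is_orbitI)
  have h: "g 0 \<in> Q" using assms g_in by blast
  show "word 0 (g 0) (g 0) \<in> hamming_verts n Q" using h h by (rule word_in)
  have act: "act (\<sigma>, \<pi>) (word 0 (g 0) (g 0)) = word 0 (\<sigma> (g 0)) (\<sigma> (g 0))"
    if "\<sigma> \<in> Bij Q" "\<pi> \<in> Bij Q" for \<sigma> \<pi>
    using act_word[of \<sigma> \<pi> "g 0" "g 0" 0] that assms h by (simp add: word_same)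
  show "code = (\<lambda>s. act s (word 0 (g 0) (g 0))) ` (Bij Q \<times> Bij Q)"
  proof (intro equalityI subsetI)
    fix v assume "v \<in> code"
    then obtain a where a: "a \<in> Q" "v = word 0 a a" by (auto simp: code_def word_same)
    obtain \<sigma> where "\<sigma> \<in> Bij Q" "\<sigma> (g 0) = a" using Bij_transitive h a(1) by metis
    then show "v \<in> (\<lambda>s. act s (word 0 (g 0) (g 0))) ` (Bij Q \<times> Bij Q)"
      using a act[OF _ id_Bij] id_Bij by (intro image_eqI[of _ _ "(\<sigma>, \<lambda>x\<in>Q. x)"]) auto
  next
    fix v assume "v \<in> (\<lambda>s. act s (word 0 (g 0) (g 0))) ` (Bij Q \<times> Bij Q)"
    then show "v \<in> code" using act h by (auto simp: code_def word_same Bij_in)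
  qed
qed

lemma dist_eq_0_iff:
  assumes "v \<in> hamming_verts n Q" "w \<in> hamming_verts n Q"
  shows "hamming_dist n v w = 0 \<longleftrightarrow> v = w"
  using assms by (auto simp: hamming_dist_def intro: vert_eqI)

lemma code_subset: "code \<subseteq> hamming_verts n Q"
  by (auto simp: code_def hamming_verts_def t_in split: if_splits)

lemma code_neighbours_eq:
  assumes "2 \<le> n"
  shows "code_neighbours n Q code = {word i h b |i h b. i < n \<and> h \<in> Q \<and> b \<in> Q \<and> h \<noteq> b}"
    (is "_ = ?W")
proof (intro equalityI subsetI)
  fix v assume "v \<in> code_neighbours n Q code"
  then have v: "v \<in> hamming_verts n Q" and ne: "code \<noteq> {}"
    and d: "Inf (hamming_dist n v ` code) = 1"
    by (auto simp: code_neighbours_def)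
  \<comment> \<open>An infimum of a nonempty set of naturals is attained, so some codeword lies at
    distance exactly one.\<close>
  have "Inf (hamming_dist n v ` code) \<in> hamming_dist n v ` code"
    using ne by (intro Inf_nat_def1) simp
  then obtain h where h: "h \<in> Q" "hamming_dist n v (\<lambda>j\<in>{..<n}. t j h) = 1"
    using d by (auto simp: code_def)
  then have "card {i. i < n \<and> v i \<noteq> t i h} = 1"
    by (simp add: hamming_dist_def cong: conj_cong)
  then obtain i where i: "{i. i < n \<and> v i \<noteq> t i h} = {i}" by (rule card_1_singletonE)
  then have i': "i < n" "v i \<noteq> t i h" by auto
  \<comment> \<open>The changed symbol is the deviating entry of \<open>v\<close>, untwisted at its
    position.\<close>
  have "v = word i h (u i (v i))"
  proof (rule vert_eqI)
    fix j assume "j < n"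
    then show "v j = word i h (u i (v i)) j"
      using i i' v by (auto simp: word_apply t_u vert_in)
  qed (use v i' h in \<open>auto intro: word_in u_in vert_in\<close>)
  moreover have "h \<noteq> u i (v i)" using i' v by (auto simp: t_u vert_in)
  ultimately show "v \<in> ?W" using i' h u_in v vert_in by blast
next
  fix v assume "v \<in> ?W"
  then obtain i h b where w: "i < n" "h \<in> Q" "b \<in> Q" "h \<noteq> b" "v = word i h b" by blast
  have v: "v \<in> hamming_verts n Q" using w word_in by simp
  have "v \<notin> code"
  proof
    assume "v \<in> code"
    then obtain k where k: "k \<in> Q" "v = word i k k" by (auto simp: code_def word_same)
    \<comment> \<open>Length at least two leaves a second position: position \<open>i\<close> forces
      the constant symbol \<open>k\<close> to be \<open>b\<close>, position \<open>j\<close> forces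
      it to be \<open>h\<close>.\<close>
    obtain j where j: "j < n" "j \<noteq> i"
    proof (cases "i = 0")
      case True then show ?thesis using assms that[of 1] by simp
    next
      case False then show ?thesis using assms that[of 0] by simp
    qed
    have "word i h b i = word i k k i" "word i h b j = word i k k j" using w k by auto
    then have "b = k" "h = k" using w k j by (auto simp: word_apply t_eq_iff)
    then show False using w by simp
  qed
  then have pos: "d \<ge> 1" if "d \<in> hamming_dist n v ` code" for d
    using that v code_subset by (auto simp: Suc_le_eq dist_eq_0_iff simp flip: neq0_conv)
  have c: "word i h h \<in> code" using w by (auto simp: code_def word_same)
  have "{j. j < n \<and> word i h b j \<noteq> word i h h j} = {i}"
    using w by (auto simp: word_apply t_eq_iff split: if_splits)
  then have "hamming_dist n v (word i h h) = 1" using w by (simp add: hamming_dist_def)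
  then have "1 \<in> hamming_dist n v ` code" using c by (metis image_eqI)
  then have "Inf (hamming_dist n v ` code) = 1"
    using pos by (intro antisym cInf_greatest) (auto intro: cInf_lower)
  then show "v \<in> code_neighbours n Q code" using v c by (auto simp: code_neighbours_def)
qed

text \<open>The two factors act independently: \<open>\<sigma>\<close> adjusts the ordered pair of
  distinct symbols by 2-transitivity, and \<open>\<pi>\<close> adjusts the position of the changed
  entry.\<close>

lemma code_neighbours_orbit:
  assumes "2 \<le> n"
  shows "is_orbit n Q (act ` (Bij Q \<times> Bij Q)) (code_neighbours n Q code)"
proof (rule is_orbitI)
  let ?x = "word 0 (g 0) (g 1)"
  have g: "g 0 \<in> Q" "g 1 \<in> Q" "g 0 \<noteq> g 1"
    using assms g_in bij_betw_imp_inj_on[OF bij_g] inj_onD[of g "{..<n}" 0 1] by auto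
  then show "?x \<in> hamming_verts n Q" by (intro word_in)
  show "code_neighbours n Q code = (\<lambda>s. act s ?x) ` (Bij Q \<times> Bij Q)"
    unfolding code_neighbours_eq[OF assms]
  proof (intro equalityI subsetI)
    fix v assume "v \<in> {word i h b |i h b. i < n \<and> h \<in> Q \<and> b \<in> Q \<and> h \<noteq> b}"
    then obtain i h b where w: "i < n" "h \<in> Q" "b \<in> Q" "h \<noteq> b" "v = word i h b" by blast
    obtain \<sigma> where \<sigma>: "\<sigma> \<in> Bij Q" "\<sigma> (g 0) = h" "\<sigma> (g 1) = b"
      using Bij_two_transitive[OF g w(2-4)] by blast
    \<comment> \<open>The changed entry at position \<open>0\<close> must arrive at position
      \<open>i\<close>, so the label of \<open>0\<close> has to go to the label of
      \<open>i\<close>.\<close>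
    obtain \<pi> where \<pi>: "\<pi> \<in> Bij Q" "\<pi> (g 0) = g i"
      using Bij_transitive[OF g(1) g_in[OF w(1)]] by blast
    have "pos \<pi> i = 0" using \<pi> w assms by (intro pos_eqI) auto
    then have "v = act (\<sigma>, \<pi>) ?x" using act_word[OF \<sigma>(1) \<pi>(1) g(1,2) w(1)] \<sigma> w by simp
    then show "v \<in> (\<lambda>s. act s ?x) ` (Bij Q \<times> Bij Q)" using \<sigma> \<pi> by blast
  next
    fix v assume "v \<in> (\<lambda>s. act s ?x) ` (Bij Q \<times> Bij Q)"
    then obtain \<sigma> \<pi> where s: "\<sigma> \<in> Bij Q" "\<pi> \<in> Bij Q" "v = act (\<sigma>, \<pi>) ?x" by auto
    obtain i where "i < n" "pos \<pi> i = 0" using pos_surj[of \<pi> 0] s assms by auto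
    then have "i < n" "v = word i (\<sigma> (g 0)) (\<sigma> (g 1))" using act_word s g by metis+
    moreover have "\<sigma> (g 0) \<in> Q" "\<sigma> (g 1) \<in> Q" "\<sigma> (g 0) \<noteq> \<sigma> (g 1)"
      using s g by (auto simp: Bij_in Bij_eq_iff)
    ultimately show "v \<in> {word i h b |i h b. i < n \<and> h \<in> Q \<and> b \<in> Q \<and> h \<noteq> b}" by blast
  qed
qed

text \<open>With a single coordinate every vertex is a twisted constant word, hence a codeword at
  distance zero from the code.\<close>

lemma code_neighbours_one:
  assumes "n = 1"
  shows "code_neighbours n Q code = {}"
proof -
  have "v \<in> code" if v: "v \<in> hamming_verts n Q" for v
  proof -
    have v0: "u 0 (v 0) \<in> Q" using v assms by (simp add: u_in vert_in)
    have "v = word 0 (u 0 (v 0)) (u 0 (v 0))"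
    proof (rule vert_eqI[OF v word_in[OF v0 v0]])
      fix i assume "i < n"
      moreover from this have "i = 0" using assms by simp
      ultimately show "v i = word 0 (u 0 (v 0)) (u 0 (v 0)) i"
        using v by (simp add: word_apply t_u vert_in)
    qed
    then show ?thesis using v0 by (auto simp: code_def word_same)
  qed
  then have "0 \<in> hamming_dist n v ` code" if "v \<in> hamming_verts n Q" for v
    using that dist_eq_0_iff[of v v] by (metis image_eqI)
  then have "Inf (hamming_dist n v ` code) = 0" if "v \<in> hamming_verts n Q" for v
    using that by (metis cInf_lower bdd_below_bot le_zero_eq)
  then show ?thesis by (auto simp: code_neighbours_def)
qed

end

section \<open>The code of a group\<close>

theorem theorem1p2:
  fixes G :: "('a, 'b) monoid_scheme" and q :: nat and g :: "nat \<Rightarrow> 'a"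
  assumes "group G" and "finite (carrier G)" and "order G = q"
    and "bij_betw g {..<q} (carrier G)"
  shows "\<exists>X. subgroup X (hamming_aut q (carrier G)) \<and>
    (hamming_aut q (carrier G))\<lparr>carrier := X\<rparr> \<cong> BijGroup (carrier G) \<times>\<times> BijGroup (carrier G) \<and>
    (if q = 1
     then is_orbit q (carrier G) X (group_code G g) \<and>
          code_neighbours q (carrier G) (group_code G g) = {}
     else neighbour_transitive q (carrier G) X (group_code G g))"
proof -
  interpret group G by (rule assms)
  have g: "g i \<in> carrier G" if "i < q" for i using that assms(4) by (auto simp: bij_betw_def)
  interpret latin_code q "carrier G" g "\<lambda>i h. g i \<otimes>\<^bsub>G\<^esub> h"
  proof
    show "bij_betw (\<lambda>h. g i \<otimes>\<^bsub>G\<^esub> h) (carrier G) (carrier G)" if "i < q" for i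
      using g[OF that] inj_on_multc surj_const_mult inj_on_cmult by (simp add: bij_betw_def)
  qed (rule assms)
  let ?B = "BijGroup (carrier G)"
  let ?X = "act ` (Bij (carrier G) \<times> Bij (carrier G))"
  have carrier: "carrier (?B \<times>\<times> ?B) = Bij (carrier G) \<times> Bij (carrier G)"
    by (simp add: DirProd_def BijGroup_def)
  have "subgroup ?X (hamming_aut q (carrier G))"
    "(hamming_aut q (carrier G))\<lparr>carrier := ?X\<rparr> \<cong> ?B \<times>\<times> ?B"
    using group_iso_image[OF DirProd_group[OF group_BijGroup group_BijGroup] group_hamming_aut
        act_hom, unfolded carrier, OF act_inj] by blast+
  \<comment> \<open>Positivity turns \<open>q \<noteq> 1\<close> into \<open>2 \<le> q\<close>,
    where the neighbours form an orbit.\<close>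
  moreover have q: "0 < q" using assms(2,3) order_gt_0_iff_finite by blast
  moreover have "group_code G g = code" by (simp add: group_code_def code_def assms(3))
  ultimately show ?thesis
    using code_orbit code_neighbours_orbit code_neighbours_one
    by (intro exI[of _ ?X]) (auto simp: neighbour_transitive_def)
qed

end
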